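(* Let $k_0$ be a fragmentation kernel. Suppose that, for some $\varepsilon>0$, $$u\in C([0,\infty);L^1((1+x^{1+\varepsilon})dx))\cap C^1((0,\infty);L^1((1+x^{1+\varepsilon})dx))$$ is a solution of the fragmentation equation $$\partial_tu(t,x)+u(t,x)=\int_x^\infty\frac1yk_0\left(\frac xy\right)u(t,y)\,dy,\qquad t>0,\ x>0,$$ with $u(0,\cdot)=u_0$. Then $$\forall\varphi\in C_0(\mathbb R^+),\qquad\lim_{t\to\infty}\int_0^\infty x\,u(t,x)\varphi(x)\,dx=M\varphi(0),\qquad\text{where }M=\int_0^\infty xu_0(x)dx.$$
   Context: A fragmentation kernel is a finite nonnegative measure $k_0$ with support contained in $[0,1]$ (written $k_0(z)dz$; integrals $\int_0^1$ against it are over $(0,1]$) such that $\int_0^1 z\,k_0(z)dz=1$ and $\int_0^1k_0(z)dz>1$. For a measure $k_0$ the right-hand side of the equation means $\int_{(0,1]}u(t,x/z)\,z^{-1}k_0(dz)$. $u$ represents a concentration of particles of size $x$ at time $t$ (nonnegative). $C_0(\mathbb R^+)$ is the space of continuous functions on $[0,\infty)$ vanishing at infinity. *)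

theory Defs
  imports "HOL-Analysis.Analysis"
begin

definition fragmentation_kernel :: "real measure \<Rightarrow> bool" where
  "fragmentation_kernel k0 \<longleftrightarrow>
     finite_measure k0 \<and> sets k0 = sets borel \<and> emeasure k0 (- {0..1}) = 0 \<and>
     (LINT z:{0<..1}|k0. z) = 1 \<and> (LINT z:{0<..1}|k0. (1::real)) > 1"

text \<open>
  The right-hand side of the equation. If \<open>k0\<close> has a density, the change of variables \<open>z = x / y\<close>
  turns this into the integral over \<open>y > x\<close> of \<open>k0 (x / y) f y / y\<close>.
  For \<open>f\<close> integrable over the half-line, the integrand is integrable for almost every \<open>x > 0\<close>,
  and the result depends only on the almost-everywhere class of \<open>f\<close>, up to null sets.
\<close>

definition frag_gain :: "real measure \<Rightarrow> (real \<Rightarrow> real) \<Rightarrow> real \<Rightarrow> real" where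
  "frag_gain k0 f x = (LINT z:{0<..1}|k0. f (x / z) / z)"

definition half_line :: "real measure" where
  "half_line = restrict_space lborel {0<..}"

definition weighted_half_line :: "real \<Rightarrow> real measure" where
  "weighted_half_line \<epsilon> = density half_line (\<lambda>x. ennreal (1 + x powr (1 + \<epsilon>)))"

text \<open>
  Elements of \<open>L\<^sup>1(M)\<close> are given by integrable representatives; continuity and differentiability
  of an \<open>L\<^sup>1(M)\<close>-valued map are with respect to the norm. The representative may be
  chosen independently at each time, so no pointwise regularity in \<open>t\<close> is implied.
\<close>

definition L1_continuous_on :: "'a measure \<Rightarrow> real set \<Rightarrow> (real \<Rightarrow> 'a \<Rightarrow> real) \<Rightarrow> bool" where
  "L1_continuous_on M S u \<longleftrightarrow>
     (\<forall>t\<in>S. integrable M (u t)) \<and>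
     (\<forall>t\<in>S. ((\<lambda>s. LINT x|M. \<bar>u s x - u t x\<bar>) \<longlongrightarrow> 0) (at t within S))"

definition L1_C1_on ::
    "'a measure \<Rightarrow> real set \<Rightarrow> (real \<Rightarrow> 'a \<Rightarrow> real) \<Rightarrow> (real \<Rightarrow> 'a \<Rightarrow> real) \<Rightarrow> bool" where
  "L1_C1_on M S u u' \<longleftrightarrow>
     (\<forall>t\<in>S. integrable M (u t)) \<and> L1_continuous_on M S u' \<and>
     (\<forall>t\<in>S. ((\<lambda>s. LINT x|M. \<bar>(u s x - u t x) / (s - t) - u' t x\<bar>) \<longlongrightarrow> 0) (at t within S))"

text \<open>
  \<open>u'\<close> is the time derivative of \<open>u\<close> in the weighted space (unique up to null sets); the
  equation and the initial condition are equalities between elements of that space.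
\<close>

definition fragmentation_solution ::
    "real measure \<Rightarrow> real \<Rightarrow> (real \<Rightarrow> real) \<Rightarrow> (real \<Rightarrow> real \<Rightarrow> real) \<Rightarrow> bool" where
  "fragmentation_solution k0 \<epsilon> u0 u \<longleftrightarrow>
     L1_continuous_on (weighted_half_line \<epsilon>) {0..} u \<and>
     (\<exists>u'. L1_C1_on (weighted_half_line \<epsilon>) {0<..} u u' \<and>
           (\<forall>t>0. AE x in half_line. u' t x + u t x = frag_gain k0 (u t) x)) \<and>
     integrable (weighted_half_line \<epsilon>) u0 \<and> (AE x in half_line. u 0 x = u0 x)"

end

theory Submission
  imports Defs
begin

text \<open>
  For \<open>p\<close> between \<open>1\<close> and \<open>1 + \<epsilon>\<close>, the moment \<open>\<integral> x\<^sup>p u(t,x) dx\<close> is a bounded linear functional on the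
  weighted space, hence a continuous function of \<open>t\<close>, differentiable for \<open>t > 0\<close>. The substitution
  \<open>x = z y\<close> and Fubini's theorem show that the gain term multiplies this moment by
  \<open>\<kappa>\<^sub>p = \<integral> z\<^sup>p k0(dz)\<close> (lemma \<open>moment_frag_gain\<close>). The moment therefore solves the linear equation
  \<open>m' = (\<kappa>\<^sub>p - 1) m\<close> and equals its initial value times \<open>exp ((\<kappa>\<^sub>p - 1) t)\<close>
  (lemma \<open>moment_solution\<close>).

  For \<open>p = 1\<close> the exponent vanishes: the mass \<open>M\<close> is conserved. For \<open>p = 1 + \<epsilon>\<close> the exponent is
  negative, because \<open>z\<^sup>1\<^sup>+\<^sup>\<epsilon> < z\<close> inside \<open>(0,1)\<close> and the kernel, which produces more than one
  fragment while preserving mass, cannot be concentrated at \<open>z = 1\<close>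
  (lemma \<open>kernel_moment_less_1\<close>). So the moment of order \<open>1 + \<epsilon>\<close> tends to \<open>0\<close>, which pushes all the
  mass to the origin: for each \<open>\<eta> > 0\<close> there is a \<open>C\<close> with
  \<open>\<bar>\<phi> x - \<phi> 0\<bar> \<le> \<eta> + C x\<^sup>\<epsilon>\<close>, and integration against \<open>x u(t,x)\<close> bounds the error by \<open>\<eta> M\<close> plus
  \<open>C\<close> times the vanishing moment.
\<close>

section \<open>Moments on the weighted space\<close>

definition moment :: "real \<Rightarrow> (real \<Rightarrow> real) \<Rightarrow> real" where
  "moment p f = (LINT x|half_line. x powr p * f x)"

definition kernel_moment :: "real measure \<Rightarrow> real \<Rightarrow> real" where
  "kernel_moment k0 p = (LINT z:{0<..1}|k0. z powr p)"

lemma space_half_line: "space half_line = {0<..}"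
  by (simp add: half_line_def space_restrict_space)

lemma borel_measurable_half_line:
  "f \<in> borel_measurable borel \<Longrightarrow> f \<in> borel_measurable half_line" for f :: "real \<Rightarrow> real"
  unfolding half_line_def by (rule measurable_restrict_space1) simp

lemma powr_measurable_half_line [measurable]: "(\<lambda>x. x powr p) \<in> borel_measurable half_line"
  by (rule borel_measurable_half_line) measurable

lemma AE_half_lineI: "(\<And>x. x > 0 \<Longrightarrow> P x) \<Longrightarrow> AE x in half_line. P x"
  by (rule AE_I2) (simp add: space_half_line)

lemma integrable_half_line_iff:
  "integrable half_line f \<longleftrightarrow> integrable lborel (\<lambda>x. indicator {0<..} x * f x)" for f :: "real \<Rightarrow> real"
  unfolding half_line_def by (subst integrable_restrict_space) auto

lemma integral_half_line:
  "integral\<^sup>L half_line f = (LINT x|lborel. indicator {0<..} x * f x)" for f :: "real \<Rightarrow> real"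
  unfolding half_line_def by (subst integral_restrict_space) auto

lemma weighted_integrable_iff:
  assumes "f \<in> borel_measurable half_line"
  shows "integrable (weighted_half_line \<epsilon>) f \<longleftrightarrow>
         integrable half_line (\<lambda>x. (1 + x powr (1 + \<epsilon>)) * f x)"
  unfolding weighted_half_line_def
  by (subst integrable_density) (use assms in \<open>auto intro!: borel_measurable_half_line add_nonneg_nonneg\<close>)

lemma weighted_integral:
  assumes "f \<in> borel_measurable half_line"
  shows "integral\<^sup>L (weighted_half_line \<epsilon>) f = (LINT x|half_line. (1 + x powr (1 + \<epsilon>)) * f x)"
  unfolding weighted_half_line_def
  by (subst integral_density) (use assms in \<open>auto intro!: borel_measurable_half_line add_nonneg_nonneg\<close>)

lemma weighted_measurable:
  "integrable (weighted_half_line \<epsilon>) f \<Longrightarrow> f \<in> borel_measurable half_line" for f :: "real \<Rightarrow> real"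
  unfolding weighted_half_line_def by (drule borel_measurable_integrable) simp

lemma powr_le_weight:
  fixes x :: real
  assumes "0 \<le> p" "p \<le> q" "x > 0"
  shows "x powr p \<le> 1 + x powr q"
proof (cases "x \<le> 1")
  case True
  then have "x powr p \<le> 1" using assms by (simp add: powr_le1)
  then show ?thesis by (simp add: add_increasing2)
next
  case False
  then have "x powr p \<le> x powr q" using assms by (intro powr_mono) auto
  then show ?thesis by simp
qed

lemma moment_integrable:
  assumes "0 \<le> p" "p \<le> 1 + \<epsilon>" and f: "integrable (weighted_half_line \<epsilon>) f"
  shows "integrable half_line (\<lambda>x. x powr p * f x)"
proof (rule Bochner_Integration.integrable_bound)
  show "integrable half_line (\<lambda>x. (1 + x powr (1 + \<epsilon>)) * f x)"
    using f weighted_integrable_iff weighted_measurable by blast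
  show "(\<lambda>x. x powr p * f x) \<in> borel_measurable half_line"
    using weighted_measurable[OF f] by (intro borel_measurable_times powr_measurable_half_line)
  show "AE x in half_line. norm (x powr p * f x) \<le> norm ((1 + x powr (1 + \<epsilon>)) * f x)"
  proof (rule AE_half_lineI)
    fix x :: real assume "x > 0"
    then have "x powr p \<le> 1 + x powr (1 + \<epsilon>)" using assms by (intro powr_le_weight) auto
    then show "norm (x powr p * f x) \<le> norm ((1 + x powr (1 + \<epsilon>)) * f x)"
      by (auto simp: abs_mult intro!: mult_right_mono)
  qed
qed

lemma moment_bound:
  assumes "0 \<le> p" "p \<le> 1 + \<epsilon>" and f: "integrable (weighted_half_line \<epsilon>) f"
  shows "\<bar>moment p f\<bar> \<le> (LINT x|weighted_half_line \<epsilon>. \<bar>f x\<bar>)"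
proof -
  have w: "integrable half_line (\<lambda>x. (1 + x powr (1 + \<epsilon>)) * \<bar>f x\<bar>)"
    using integrable_abs[OF f] weighted_integrable_iff weighted_measurable by blast
  have "\<bar>moment p f\<bar> \<le> (LINT x|half_line. \<bar>x powr p * f x\<bar>)"
    unfolding moment_def by (rule integral_abs_bound)
  also have "\<dots> \<le> (LINT x|half_line. (1 + x powr (1 + \<epsilon>)) * \<bar>f x\<bar>)"
  proof (rule integral_mono_AE)
    show "AE x in half_line. \<bar>x powr p * f x\<bar> \<le> (1 + x powr (1 + \<epsilon>)) * \<bar>f x\<bar>"
      by (rule AE_half_lineI) (use assms in \<open>auto simp: abs_mult intro!: mult_right_mono powr_le_weight\<close>)
  qed (use w moment_integrable[OF assms] in auto)
  also have "\<dots> = (LINT x|weighted_half_line \<epsilon>. \<bar>f x\<bar>)"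
    using weighted_measurable[OF integrable_abs[OF f]] by (rule weighted_integral[symmetric])
  finally show ?thesis .
qed

lemma moment_diff:
  assumes "0 \<le> p" "p \<le> 1 + \<epsilon>"
    and "integrable (weighted_half_line \<epsilon>) f" "integrable (weighted_half_line \<epsilon>) g"
  shows "moment p (\<lambda>x. f x - g x) = moment p f - moment p g"
  unfolding moment_def
  using moment_integrable[OF assms(1,2,3)] moment_integrable[OF assms(1,2,4)]
  by (simp add: right_diff_distrib)

lemma moment_divide: "moment p (\<lambda>x. f x / c) = moment p f / c"
  unfolding moment_def times_divide_eq_right by (rule integral_divide_zero)

lemma moment_cong_AE:
  assumes "AE x in half_line. f x = g x"
    and "f \<in> borel_measurable half_line" "g \<in> borel_measurable half_line"
  shows "moment p f = moment p g"
  unfolding moment_def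
  using assms
  by (intro integral_cong_AE borel_measurable_times powr_measurable_half_line) auto

section \<open>Moments of the gain term and of the kernel\<close>

text \<open>
  If the integrand is rewritten through \<open>F y = y\<^sup>p f(y)\<close> (extended by \<open>0\<close>), the weight \<open>x\<^sup>p\<close> becomes
  the factor \<open>z\<^sup>p\<close>, and for fixed \<open>z\<close> the remaining integral of \<open>F (x / z) / z\<close> over \<open>x\<close> does not
  depend on \<open>z\<close>.
\<close>

lemma moment_frag_gain:
  assumes k0: "finite_measure k0" "sets k0 = sets borel"
    and p: "0 \<le> p"
    and f: "integrable half_line (\<lambda>x. x powr p * f x)"
  shows "moment p (frag_gain k0 f) = kernel_moment k0 p * moment p f"
proof -
  interpret k0: finite_measure k0 by fact
  interpret P: pair_sigma_finite k0 lborel ..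
  have [measurable_cong]: "sets k0 = sets borel" by fact
  define F where "F y = indicator {0<..} y * (y powr p * f y)" for y :: real
  define H where "H z x = indicator {0<..1} z * z powr p * (F (x / z) / z)" for z x :: real
  have F: "integrable lborel F"
    using f unfolding F_def integrable_half_line_iff .
  then have [measurable]: "F \<in> borel_measurable borel" by simp
  have scale: "has_bochner_integral lborel (\<lambda>x. G (x / z) / z) (integral\<^sup>L lborel G)"
    if "integrable lborel G" "z > 0" for G :: "real \<Rightarrow> real" and z :: real
  proof -
    have "has_bochner_integral lborel (\<lambda>x. G (0 + inverse z * x)) (integral\<^sup>L lborel G /\<^sub>R \<bar>inverse z\<bar>)"
      using that has_bochner_integral_integrable[OF that(1)]
      by (subst lborel_has_bochner_integral_real_affine_iff[symmetric, of "inverse z"]) auto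
    from has_bochner_integral_divide_zero[OF this, of z] that(2)
    show ?thesis by (simp add: field_simps)
  qed
  have inner: "integrable lborel (H z)"
    "integral\<^sup>L lborel (H z) = indicator {0<..1} z * z powr p * integral\<^sup>L lborel F"
    "(LINT x|lborel. \<bar>H z x\<bar>) = indicator {0<..1} z * z powr p * (LINT y|lborel. \<bar>F y\<bar>)" for z
  proof -
    have "integrable lborel (H z) \<and>
      integral\<^sup>L lborel (H z) = indicator {0<..1} z * z powr p * integral\<^sup>L lborel F \<and>
      (LINT x|lborel. \<bar>H z x\<bar>) = indicator {0<..1} z * z powr p * (LINT y|lborel. \<bar>F y\<bar>)"
    proof (cases "z \<in> {0<..1}")
      case True
      then have "z > 0" by simp
      have "H z = (\<lambda>x. z powr p * (F (x / z) / z))" "(\<lambda>x. \<bar>H z x\<bar>) = (\<lambda>x. z powr p * (\<bar>F (x / z)\<bar> / z))"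
        using True by (auto simp: H_def fun_eq_iff abs_mult)
      then have "has_bochner_integral lborel (H z) (z powr p * integral\<^sup>L lborel F)"
        "has_bochner_integral lborel (\<lambda>x. \<bar>H z x\<bar>) (z powr p * (LINT y|lborel. \<bar>F y\<bar>))"
        using scale[OF F \<open>z > 0\<close>] scale[OF integrable_abs[OF F] \<open>z > 0\<close>]
        by (simp_all only: has_bochner_integral_mult_right)
      then show ?thesis
        using True by (simp add: has_bochner_integral_iff)
    next
      case False
      then have "H z = (\<lambda>_. 0)" by (auto simp: H_def)
      then show ?thesis using False by simp
    qed
    then show "integrable lborel (H z)"
      "integral\<^sup>L lborel (H z) = indicator {0<..1} z * z powr p * integral\<^sup>L lborel F"
      "(LINT x|lborel. \<bar>H z x\<bar>) = indicator {0<..1} z * z powr p * (LINT y|lborel. \<bar>F y\<bar>)"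
      by auto
  qed
  have zp: "integrable k0 (\<lambda>z. indicator {0<..1} z * z powr p)"
    by (rule k0.integrable_const_bound[where B = 1])
      (use p in \<open>auto intro!: AE_I2 simp: indicator_def powr_le1\<close>)
  have "integrable (k0 \<Otimes>\<^sub>M lborel) (\<lambda>(z, x). H z x)"
  proof (rule P.Fubini_integrable)
    show "(\<lambda>(z, x). H z x) \<in> borel_measurable (k0 \<Otimes>\<^sub>M lborel)"
      unfolding H_def by measurable
    show "integrable k0 (\<lambda>z. LINT x|lborel. norm (case (z, x) of (z, x) \<Rightarrow> H z x))"
      using zp by (simp add: inner)
    show "AE z in k0. integrable lborel (\<lambda>x. case (z, x) of (z, x) \<Rightarrow> H z x)"
      by (simp add: inner)
  qed
  then have Fubini: "(LINT x|lborel. LINT z|k0. H z x) = (LINT z|k0. LINT x|lborel. H z x)"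
    by (rule P.Fubini_integral)
  have "indicator {0<..} x * (x powr p * frag_gain k0 f x) = (LINT z|k0. H z x)" for x :: real
  proof (cases "x > 0")
    case True
    have "H z x = x powr p * (indicator {0<..1} z *\<^sub>R (f (x / z) / z))" for z
    proof (cases "z \<in> {0<..1}")
      case z: True
      then have "z powr p * (x / z) powr p = x powr p"
        using True by (simp add: powr_divide)
      then show ?thesis
        using z True by (simp add: H_def F_def mult.assoc[symmetric])
    qed (simp add: H_def)
    then have "(LINT z|k0. H z x) = x powr p * (LINT z|k0. indicator {0<..1} z *\<^sub>R (f (x / z) / z))"
      by (simp only: integral_mult_right_zero)
    then show ?thesis
      using True by (simp add: frag_gain_def set_lebesgue_integral_def)
  next
    case False
    then have "H z x = 0" for z
      by (auto simp: H_def F_def indicator_def zero_less_divide_iff)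
    with False show ?thesis by simp
  qed
  then have "moment p (frag_gain k0 f) = (LINT x|lborel. LINT z|k0. H z x)"
    by (simp add: moment_def integral_half_line)
  also have "\<dots> = (LINT z|k0. indicator {0<..1} z * z powr p * integral\<^sup>L lborel F)"
    by (simp add: Fubini inner)
  also have "\<dots> = kernel_moment k0 p * moment p f"
    by (simp add: kernel_moment_def set_lebesgue_integral_def moment_def integral_half_line F_def[abs_def])
  finally show ?thesis .
qed

lemma kernel_moment_1:
  assumes "fragmentation_kernel k0"
  shows "kernel_moment k0 1 = 1"
proof -
  have "kernel_moment k0 1 = (LINT z:{0<..1}|k0. z)"
    unfolding kernel_moment_def set_lebesgue_integral_def
    by (rule Bochner_Integration.integral_cong) (auto simp: indicator_def)
  then show ?thesis using assms by (simp add: fragmentation_kernel_def)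
qed

text \<open>
  Otherwise \<open>z\<^sup>q = z\<close> for almost every \<open>z\<close> in \<open>(0,1]\<close>, so that \<open>z = 1\<close> there, and the number of
  fragments \<open>\<integral> k0(dz)\<close> would equal their mass \<open>\<integral> z k0(dz) = 1\<close>.
\<close>

lemma kernel_moment_less_1:
  assumes k: "fragmentation_kernel k0" and q: "q > 1"
  shows "kernel_moment k0 q < 1"
proof -
  interpret k0: finite_measure k0 using k by (simp add: fragmentation_kernel_def)
  have [measurable_cong]: "sets k0 = sets borel" using k by (simp add: fragmentation_kernel_def)
  define A where "A = {0<..1::real}"
  have mass: "(LINT z|k0. indicator A z * z) = 1" and number: "(LINT z|k0. indicator A z) > (1::real)"
    using k unfolding fragmentation_kernel_def set_lebesgue_integral_def A_def by simp_all
  have [measurable]: "A \<in> sets borel" by (simp add: A_def)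
  have i1: "integrable k0 (\<lambda>z. indicator A z * z)"
    by (rule k0.integrable_const_bound[where B = 1]) (auto intro!: AE_I2 simp: indicator_def A_def)
  have i2: "integrable k0 (\<lambda>z. indicator A z * z powr q)"
    by (rule k0.integrable_const_bound[where B = 1])
      (use q in \<open>auto intro!: AE_I2 simp: indicator_def A_def powr_le1\<close>)
  have strict: "z powr q < z" if "z \<in> A" "z \<noteq> 1" for z
    using that q powr_less_mono'[of z 1 q] by (auto simp: A_def)
  then have le: "z powr q \<le> z" if "z \<in> A" for z
    using that by (cases "z = 1") (auto intro: less_imp_le)
  have pos: "AE z in k0. 0 \<le> indicator A z * z - indicator A z * z powr q"
    using le by (intro AE_I2) (auto simp: indicator_def)
  have km: "kernel_moment k0 q = (LINT z|k0. indicator A z * z powr q)"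
    by (simp add: kernel_moment_def set_lebesgue_integral_def A_def)
  have diff: "(LINT z|k0. indicator A z * z - indicator A z * z powr q) = 1 - kernel_moment k0 q"
    using i1 i2 mass by (simp add: km)
  have "kernel_moment k0 q \<noteq> 1"
  proof
    assume "kernel_moment k0 q = 1"
    then have "AE z in k0. indicator A z * z - indicator A z * z powr q = 0"
      using integral_nonneg_eq_0_iff_AE[OF Bochner_Integration.integrable_diff[OF i1 i2] pos] diff
      by simp
    then have "AE z in k0. indicator A z = indicator A z * z"
    proof eventually_elim
      case (elim z)
      then show ?case using strict[of z] by (cases "z = 1") (auto simp: indicator_def split: if_splits)
    qed
    then have "(LINT z|k0. indicator A z) = (LINT z|k0. indicator A z * z)"
      by (intro integral_cong_AE) auto
    then show False using mass number by simp
  qed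
  moreover have "0 \<le> 1 - kernel_moment k0 q"
    using integral_nonneg_AE[OF pos] diff by simp
  ultimately show ?thesis by simp
qed

section \<open>Evolution of the moments\<close>

lemma linear_ode_solution:
  fixes m :: "real \<Rightarrow> real"
  assumes cont: "continuous_on {0..} m"
    and deriv: "\<And>t. t > 0 \<Longrightarrow> (m has_real_derivative c * m t) (at t)"
    and t: "t \<ge> 0"
  shows "m t = m 0 * exp (c * t)"
proof (cases "t = 0")
  case False
  define g where "g s = exp (- c * s) * m s" for s
  have "g t = g 0"
  proof (rule DERIV_isconst_end[of 0 t g])
    show "0 < t" using t False by simp
    show "continuous_on {0..t} g"
      unfolding g_def by (intro continuous_intros continuous_on_subset[OF cont]) auto
    show "(g has_real_derivative 0) (at s)" if "0 < s" "s < t" for s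
      unfolding g_def using that
      by (auto intro!: derivative_eq_intros deriv)
  qed
  then show ?thesis by (simp add: g_def exp_minus field_simps)
qed simp

text \<open>
  The time derivative of a moment is the moment of the time derivative, so integrating the
  equation against \<open>x\<^sup>p\<close> gives a scalar linear differential equation. It holds only for \<open>t > 0\<close>;
  continuity at \<open>t = 0\<close> carries the solution formula down to the initial datum.
\<close>

lemma moment_solution:
  assumes k: "fragmentation_kernel k0" and p: "0 \<le> p" "p \<le> 1 + \<epsilon>"
    and sol: "fragmentation_solution k0 \<epsilon> u0 u" and t: "t \<ge> 0"
  shows "moment p (u t) = moment p u0 * exp ((kernel_moment k0 p - 1) * t)"
proof -
  obtain u' where cont: "L1_continuous_on (weighted_half_line \<epsilon>) {0..} u"
    and C1: "L1_C1_on (weighted_half_line \<epsilon>) {0<..} u u'"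
    and eq: "\<And>t. t > 0 \<Longrightarrow> AE x in half_line. u' t x + u t x = frag_gain k0 (u t) x"
    and u0: "integrable (weighted_half_line \<epsilon>) u0" "AE x in half_line. u 0 x = u0 x"
    using sol unfolding fragmentation_solution_def by blast
  have iu: "integrable (weighted_half_line \<epsilon>) (u t)" if "t \<ge> 0" for t
    using cont that by (simp add: L1_continuous_on_def)
  have iu': "integrable (weighted_half_line \<epsilon>) (u' t)" if "t > 0" for t
    using C1 that by (simp add: L1_C1_on_def L1_continuous_on_def)
  have m_cont: "continuous_on {0..} (\<lambda>t. moment p (u t))"
    unfolding continuous_on_def
  proof
    fix t :: real assume t: "t \<in> {0..}"
    show "((\<lambda>s. moment p (u s)) \<longlongrightarrow> moment p (u t)) (at t within {0..})"
    proof (rule LIM_zero_cancel, rule Lim_null_comparison[rotated])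
      show "((\<lambda>s. LINT x|weighted_half_line \<epsilon>. \<bar>u s x - u t x\<bar>) \<longlongrightarrow> 0) (at t within {0..})"
        using cont t by (simp add: L1_continuous_on_def)
      have "norm (moment p (u s) - moment p (u t)) \<le> (LINT x|weighted_half_line \<epsilon>. \<bar>u s x - u t x\<bar>)"
        if "s \<ge> 0" for s
        using moment_bound[OF p, of "\<lambda>x. u s x - u t x"] moment_diff[OF p iu[of s] iu[of t]]
          iu[of s] iu[of t] that t by simp
      then show "\<forall>\<^sub>F s in at t within {0..}. norm (moment p (u s) - moment p (u t))
                   \<le> (LINT x|weighted_half_line \<epsilon>. \<bar>u s x - u t x\<bar>)"
        by (simp add: eventually_at_filter)
    qed
  qed
  have m_deriv: "((\<lambda>t. moment p (u t)) has_real_derivative moment p (u' t)) (at t)"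
    if t: "t > 0" for t
    unfolding has_field_derivative_iff
  proof (rule LIM_zero_cancel, rule Lim_null_comparison[rotated])
    have "((\<lambda>s. LINT x|weighted_half_line \<epsilon>. \<bar>(u s x - u t x) / (s - t) - u' t x\<bar>) \<longlongrightarrow> 0)
            (at t within {0<..})"
      using C1 t unfolding L1_C1_on_def by blast
    moreover have "at t within {0<..} = at t" using t by (intro at_within_open) auto
    ultimately show "((\<lambda>s. LINT x|weighted_half_line \<epsilon>. \<bar>(u s x - u t x) / (s - t) - u' t x\<bar>) \<longlongrightarrow> 0) (at t)"
      by simp
    have bd: "norm ((moment p (u s) - moment p (u t)) / (s - t) - moment p (u' t))
          \<le> (LINT x|weighted_half_line \<epsilon>. \<bar>(u s x - u t x) / (s - t) - u' t x\<bar>)" if "s > 0" for s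
    proof -
      have i: "integrable (weighted_half_line \<epsilon>) (\<lambda>x. (u s x - u t x) / (s - t))"
        using iu[of s] iu[of t] that t by simp
      have "moment p (\<lambda>x. (u s x - u t x) / (s - t) - u' t x)
              = (moment p (u s) - moment p (u t)) / (s - t) - moment p (u' t)"
        using moment_diff[OF p i iu'[OF t]] moment_diff[OF p iu[of s] iu[of t]] that t
        by (simp add: moment_divide)
      then show ?thesis
        using moment_bound[OF p Bochner_Integration.integrable_diff[OF i iu'[OF t]]]
        by simp
    qed
    have "\<forall>\<^sub>F s in at t. s > 0"
      using t eventually_at_in_open'[of "{0<..}" t] by simp
    then show "\<forall>\<^sub>F s in at t. norm ((moment p (u s) - moment p (u t)) / (s - t) - moment p (u' t))
                 \<le> (LINT x|weighted_half_line \<epsilon>. \<bar>(u s x - u t x) / (s - t) - u' t x\<bar>)"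
      by eventually_elim (rule bd)
  qed
  have m_ode: "moment p (u' t) = (kernel_moment k0 p - 1) * moment p (u t)" if t: "t > 0" for t
  proof -
    have iut: "integrable (weighted_half_line \<epsilon>) (u t)" using iu t by simp
    have gain_meas: "frag_gain k0 (u t) \<in> borel_measurable half_line"
    proof -
      interpret k0: finite_measure k0 using k by (simp add: fragmentation_kernel_def)
      have [measurable_cong]: "sets k0 = sets borel" using k by (simp add: fragmentation_kernel_def)
      \<comment> \<open>A version of \<open>u t\<close> that is measurable on the whole line, as needed for the composition with \<open>x / z\<close>.\<close>
      define v where "v y = indicator {0<..} y * u t y" for y :: real
      have [measurable]: "v \<in> borel_measurable borel"
        using weighted_measurable[OF iut] unfolding half_line_def v_def
        by (subst (asm) borel_measurable_restrict_space_iff) auto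
      have "(\<lambda>x. LINT z|k0. indicator {0<..1} z *\<^sub>R (v (x / z) / z)) \<in> borel_measurable half_line"
        by (rule borel_measurable_half_line) measurable
      moreover have "frag_gain k0 (u t) x = (LINT z|k0. indicator {0<..1} z *\<^sub>R (v (x / z) / z))"
        if "x \<in> space half_line" for x
        using that unfolding frag_gain_def set_lebesgue_integral_def
        by (intro Bochner_Integration.integral_cong)
           (auto simp: v_def space_half_line indicator_def zero_less_divide_iff)
      ultimately show ?thesis by (subst measurable_cong) auto
    qed
    have "AE x in half_line. u' t x = frag_gain k0 (u t) x - u t x"
      using eq[OF t] by eventually_elim simp
    then have ae: "AE x in half_line. u' t x - - u t x = frag_gain k0 (u t) x"
      by eventually_elim simp
    have "moment p (u' t) + moment p (u t) = moment p (\<lambda>x. u' t x - - u t x)"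
      using moment_integrable[OF p iu'[OF t]] moment_integrable[OF p iut]
      by (simp add: moment_def distrib_left)
    also have "\<dots> = moment p (frag_gain k0 (u t))"
      using ae gain_meas weighted_measurable[OF iut] weighted_measurable[OF iu'[OF t]]
      by (intro moment_cong_AE) auto
    also have "\<dots> = kernel_moment k0 p * moment p (u t)"
      using k p moment_integrable[OF p iut]
      by (intro moment_frag_gain) (auto simp: fragmentation_kernel_def)
    finally show ?thesis by (simp add: algebra_simps)
  qed
  have "moment p (u t) = moment p (u 0) * exp ((kernel_moment k0 p - 1) * t)"
    by (rule linear_ode_solution[OF m_cont _ t]) (use m_deriv m_ode in auto)
  also have "moment p (u 0) = moment p u0"
    using u0 iu[of 0] weighted_measurable by (intro moment_cong_AE) auto
  finally show ?thesis .
qed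

section \<open>Concentration of the mass at the origin\<close>

lemma C0_bounded:
  fixes \<phi> :: "real \<Rightarrow> real"
  assumes cont: "continuous_on {0..} \<phi>" and lim: "(\<phi> \<longlongrightarrow> 0) at_top"
  obtains B where "\<And>x. x \<ge> 0 \<Longrightarrow> \<bar>\<phi> x\<bar> \<le> B"
proof -
  have "\<forall>\<^sub>F x in at_top. dist (\<phi> x) 0 < 1" using lim by (rule tendstoD) simp
  then obtain N where N: "\<And>x. x \<ge> N \<Longrightarrow> \<bar>\<phi> x\<bar> < 1"
    by (auto simp: eventually_at_top_linorder)
  have "compact (\<phi> ` {0..N})"
    by (intro compact_continuous_image continuous_on_subset[OF cont]) auto
  then have "bounded (\<phi> ` {0..N})" by (rule compact_imp_bounded)
  then obtain b where "\<forall>y\<in>\<phi> ` {0..N}. norm y \<le> b" unfolding bounded_iff by blast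
  then have b: "\<bar>\<phi> x\<bar> \<le> b" if "x \<in> {0..N}" for x
    using that by simp
  show ?thesis
  proof (rule that)
    fix x :: real assume "x \<ge> 0"
    then show "\<bar>\<phi> x\<bar> \<le> max b 1"
      using N[of x] b[of x] by (cases "x \<ge> N") (auto simp: max_def)
  qed
qed

text \<open>
  Continuity at \<open>0\<close> handles small \<open>x\<close>. For \<open>x\<close> beyond some \<open>\<delta>\<close>, the factor \<open>(x / \<delta>)\<^sup>\<epsilon>\<close> is at least \<open>1\<close>
  and boundedness suffices.
\<close>

lemma C0_modulus_at_0:
  fixes \<phi> :: "real \<Rightarrow> real"
  assumes cont: "continuous_on {0..} \<phi>" and lim: "(\<phi> \<longlongrightarrow> 0) at_top"
    and \<epsilon>: "\<epsilon> > 0" and \<eta>: "\<eta> > 0"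
  obtains C where "C \<ge> 0" "\<And>x. x > 0 \<Longrightarrow> \<bar>\<phi> x - \<phi> 0\<bar> \<le> \<eta> + C * x powr \<epsilon>"
proof -
  obtain B where B: "\<And>x. x \<ge> 0 \<Longrightarrow> \<bar>\<phi> x\<bar> \<le> B" using C0_bounded[OF cont lim] by blast
  obtain \<delta> where \<delta>: "\<delta> > 0" "\<And>x. x \<ge> 0 \<Longrightarrow> \<bar>x\<bar> < \<delta> \<Longrightarrow> \<bar>\<phi> x - \<phi> 0\<bar> < \<eta>"
    using cont \<eta> unfolding continuous_on_iff dist_real_def by (metis atLeast_iff diff_zero order_refl)
  define C where "C = 2 * B / \<delta> powr \<epsilon>"
  have "B \<ge> 0" using B[of 0] by linarith
  then have C: "C \<ge> 0" by (simp add: C_def)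
  moreover have "\<bar>\<phi> x - \<phi> 0\<bar> \<le> \<eta> + C * x powr \<epsilon>" if x: "x > 0" for x
  proof (cases "x < \<delta>")
    case True
    then have "\<bar>\<phi> x - \<phi> 0\<bar> < \<eta>" using \<delta>(2)[of x] x by simp
    moreover have "0 \<le> C * x powr \<epsilon>" using C by simp
    ultimately show ?thesis by linarith
  next
    case False
    have "\<bar>\<phi> x - \<phi> 0\<bar> \<le> 2 * B" using B[of x] B[of 0] x by linarith
    also have "\<dots> = C * \<delta> powr \<epsilon>" using \<delta>(1) by (simp add: C_def)
    also have "\<dots> \<le> C * x powr \<epsilon>"
      using False \<delta>(1) \<epsilon> C by (intro mult_left_mono powr_mono2) auto
    finally show ?thesis using \<eta> by linarith
  qed
  ultimately show ?thesis using that by blast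
qed

lemma C0_test_error:
  assumes \<phi>: "continuous_on {0..} \<phi>" "(\<phi> \<longlongrightarrow> 0) at_top" and \<epsilon>: "\<epsilon> > 0"
    and v: "integrable (weighted_half_line \<epsilon>) v" "AE x in half_line. 0 \<le> v x"
    and C: "\<And>x. x > 0 \<Longrightarrow> \<bar>\<phi> x - \<phi> 0\<bar> \<le> \<eta> + C * x powr \<epsilon>"
  shows "\<bar>(LINT x|half_line. x * v x * \<phi> x) - moment 1 v * \<phi> 0\<bar>
           \<le> \<eta> * moment 1 v + C * moment (1 + \<epsilon>) v"
proof -
  obtain B where B: "\<And>x. x \<ge> 0 \<Longrightarrow> \<bar>\<phi> x\<bar> \<le> B" using C0_bounded[OF \<phi>] by blast
  have i1: "integrable half_line (\<lambda>x. x powr 1 * v x)"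
    and i2: "integrable half_line (\<lambda>x. x powr (1 + \<epsilon>) * v x)"
    using \<epsilon> moment_integrable[OF _ _ v(1), of 1] moment_integrable[OF _ _ v(1), of "1 + \<epsilon>"] by simp_all
  have x1: "integrable half_line (\<lambda>x. x * v x)"
    using i1 by (rule Bochner_Integration.integrable_cong[THEN iffD1, rotated 2])
      (auto simp: space_half_line)
  have m1: "moment 1 v = (LINT x|half_line. x * v x)"
    unfolding moment_def
    by (rule Bochner_Integration.integral_cong) (auto simp: space_half_line)
  have "\<phi> \<in> borel_measurable (restrict_space borel {0<..})"
    by (rule borel_measurable_continuous_on_restrict) (rule continuous_on_subset[OF \<phi>(1)], auto)
  then have \<phi>m: "\<phi> \<in> borel_measurable half_line"
    unfolding half_line_def by (simp add: measurable_def space_restrict_space sets_restrict_space)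
  have x\<phi>: "integrable half_line (\<lambda>x. x * v x * \<phi> x)"
  proof (rule Bochner_Integration.integrable_bound)
    show "integrable half_line (\<lambda>x. x * v x * B)" using x1 by simp
    show "(\<lambda>x. x * v x * \<phi> x) \<in> borel_measurable half_line"
      using \<phi>m borel_measurable_integrable[OF x1] by (rule borel_measurable_times[rotated])
    show "AE x in half_line. norm (x * v x * \<phi> x) \<le> norm (x * v x * B)"
      by (rule AE_half_lineI) (auto simp: abs_mult intro!: mult_left_mono order_trans[OF B])
  qed
  have "(LINT x|half_line. x * v x * \<phi> x) - moment 1 v * \<phi> 0
          = (LINT x|half_line. x * v x * \<phi> x - x * v x * \<phi> 0)"
    using x\<phi> x1 by (simp add: m1)
  also have "\<bar>\<dots>\<bar> \<le> (LINT x|half_line. \<bar>x * v x * \<phi> x - x * v x * \<phi> 0\<bar>)"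
    by (rule integral_abs_bound)
  also have "\<dots> \<le> (LINT x|half_line. \<eta> * (x powr 1 * v x) + C * (x powr (1 + \<epsilon>) * v x))"
  proof (rule integral_mono_AE)
    have "AE x in half_line. 0 < x" by (rule AE_half_lineI)
    with v(2) show "AE x in half_line. \<bar>x * v x * \<phi> x - x * v x * \<phi> 0\<bar>
            \<le> \<eta> * (x powr 1 * v x) + C * (x powr (1 + \<epsilon>) * v x)"
    proof eventually_elim
      case (elim x)
      have "\<bar>x * v x * \<phi> x - x * v x * \<phi> 0\<bar> = x * v x * \<bar>\<phi> x - \<phi> 0\<bar>"
        using elim by (simp add: right_diff_distrib[symmetric] abs_mult)
      also have "\<dots> \<le> x * v x * (\<eta> + C * x powr \<epsilon>)"
        using elim C by (intro mult_left_mono) auto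
      also have "\<dots> = \<eta> * (x powr 1 * v x) + C * (x powr (1 + \<epsilon>) * v x)"
        using elim by (simp add: powr_add algebra_simps)
      finally show ?case .
    qed
  qed (use x\<phi> x1 i1 i2 in auto)
  also have "\<dots> = \<eta> * moment 1 v + C * moment (1 + \<epsilon>) v"
    using i1 i2 by (simp add: moment_def)
  finally show ?thesis .
qed

theorem theorem4p1:
  fixes k0 :: "real measure" and \<epsilon> :: real
    and u0 :: "real \<Rightarrow> real" and u :: "real \<Rightarrow> real \<Rightarrow> real"
  assumes "fragmentation_kernel k0"
    and "\<epsilon> > 0"
    and "fragmentation_solution k0 \<epsilon> u0 u"
    and "\<forall>t\<ge>0. AE x in half_line. 0 \<le> u t x"
  shows "\<forall>\<phi> :: real \<Rightarrow> real. continuous_on {0..} \<phi> \<and> (\<phi> \<longlongrightarrow> 0) at_top \<longrightarrow>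
           ((\<lambda>t. LINT x|half_line. x * u t x * \<phi> x) \<longlongrightarrow> (LINT x|half_line. x * u0 x) * \<phi> 0) at_top"
proof (intro allI impI, elim conjE)
  fix \<phi> :: "real \<Rightarrow> real"
  assume \<phi>: "continuous_on {0..} \<phi>" "(\<phi> \<longlongrightarrow> 0) at_top"
  define M where "M = moment 1 u0"
  define Q where "Q t = moment (1 + \<epsilon>) (u t)" for t
  have M: "M = (LINT x|half_line. x * u0 x)"
    unfolding M_def moment_def
    by (rule Bochner_Integration.integral_cong) (auto simp: space_half_line)
  have iu: "integrable (weighted_half_line \<epsilon>) (u t)" if "t \<ge> 0" for t
    using assms(3) that by (simp add: fragmentation_solution_def L1_continuous_on_def)
  have mass: "moment 1 (u t) = M" if "t \<ge> 0" for t
    using moment_solution[OF assms(1) _ _ assms(3) that, of 1] assms(2) kernel_moment_1[OF assms(1)]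
    by (simp add: M_def)
  have "\<forall>\<^sub>F t in at_top. Q t = moment (1 + \<epsilon>) u0 * exp ((kernel_moment k0 (1 + \<epsilon>) - 1) * t)"
    using eventually_ge_at_top[of 0]
    by eventually_elim (use moment_solution[OF assms(1) _ _ assms(3)] assms(2) in \<open>simp add: Q_def\<close>)
  moreover have "((\<lambda>t. exp ((kernel_moment k0 (1 + \<epsilon>) - 1) * t)) \<longlongrightarrow> 0) at_top"
    using kernel_moment_less_1[OF assms(1), of "1 + \<epsilon>"] assms(2)
    by (intro filterlim_compose[OF exp_at_bot]
        filterlim_tendsto_neg_mult_at_bot[OF tendsto_const _ filterlim_ident]) auto
  ultimately have Q: "(Q \<longlongrightarrow> 0) at_top"
    by (simp add: filterlim_cong tendsto_mult_right_zero)
  have "M \<ge> 0"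
    using assms(4) mass[of 0, symmetric] unfolding moment_def
    by (auto intro!: integral_nonneg_AE elim!: eventually_mono)
  have "((\<lambda>t. LINT x|half_line. x * u t x * \<phi> x) \<longlongrightarrow> M * \<phi> 0) at_top"
  proof (rule tendstoI)
    fix e :: real assume "e > 0"
    \<comment> \<open>The summand \<open>1\<close> keeps the denominator positive when \<open>M = 0\<close>.\<close>
    define \<eta> where "\<eta> = e / (2 * (M + 1))"
    have \<eta>: "\<eta> > 0" "\<eta> * M < e / 2"
      using \<open>e > 0\<close> \<open>M \<ge> 0\<close> by (auto simp: \<eta>_def field_simps)
    obtain C where C: "C \<ge> 0" "\<And>x. x > 0 \<Longrightarrow> \<bar>\<phi> x - \<phi> 0\<bar> \<le> \<eta> + C * x powr \<epsilon>"
      using C0_modulus_at_0[OF \<phi> assms(2) \<eta>(1)] by blast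
    have "((\<lambda>t. C * Q t) \<longlongrightarrow> 0) at_top" using Q by (rule tendsto_mult_right_zero)
    then have "\<forall>\<^sub>F t in at_top. C * Q t < e / 2"
      by (rule order_tendstoD) (use \<open>e > 0\<close> in simp)
    then show "\<forall>\<^sub>F t in at_top. dist (LINT x|half_line. x * u t x * \<phi> x) (M * \<phi> 0) < e"
      using eventually_ge_at_top[of 0]
    proof eventually_elim
      case (elim t)
      have "\<bar>(LINT x|half_line. x * u t x * \<phi> x) - M * \<phi> 0\<bar> \<le> \<eta> * M + C * Q t"
        using C0_test_error[OF \<phi> assms(2) iu[of t] _ C(2)] assms(4) elim mass[of t]
        by (simp add: Q_def)
      then show ?case using \<eta>(2) elim by (simp add: dist_real_def)
    qed
  qed
  then show "((\<lambda>t. LINT x|half_line. x * u t x * \<phi> x)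
                \<longlongrightarrow> (LINT x|half_line. x * u0 x) * \<phi> 0) at_top"
    by (simp add: M)
qed

end
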